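(* For every integer $n\ge 6$ there exist a set $P$ of $n$ points in general position in the plane and a family $\mathcal{S}$ of subsets of $P$ such that $C(\mathcal{S})$ is a convex hull thrackle on $P$ consisting of $n+1$ convex hulls.
   Context: Points are in general position if no three are collinear. Given a set $P$ of $n$ points in general position in the plane and a family $\mathcal{S}$ of subsets of $P$ whose convex hulls are pairwise different, let $C(\mathcal{S})=\{\mathrm{Conv}(S):S\in\mathcal{S}\}$, where $\mathrm{Conv}(S)$ is the convex hull of $S$. $C(\mathcal{S})$ is a convex hull thrackle on $P$ if: (1) $C_1\not\subset C_2$ for any two different $C_1,C_2\in C(\mathcal{S})$; (2) $C_1\cap C_2\neq\emptyset$ for any two different $C_1,C_2\in C(\mathcal{S})$; (3) $C_1\cap C_2\cap C_3\subset P$ for any three different $C_1,C_2,C_3\in C(\mathcal{S})$. The number of convex hulls is $|C(\mathcal{S})|=|\mathcal{S}|$. *)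

theory Defs
  imports "HOL-Analysis.Analysis"
begin

type_synonym point = "real ^ 2"

definition general_position :: "point set \<Rightarrow> bool" where
  "general_position P \<longleftrightarrow>
     (\<forall>x\<in>P. \<forall>y\<in>P. \<forall>z\<in>P. x \<noteq> y \<and> x \<noteq> z \<and> y \<noteq> z \<longrightarrow> \<not> collinear {x, y, z})"

definition conv_hulls :: "point set set \<Rightarrow> point set set" where
  "conv_hulls F = (\<lambda>S. convex hull S) ` F"

text \<open>The predicate is about the family \<^term>\<open>F\<close> of vertex sets rather than its image
  \<^term>\<open>conv_hulls F\<close>, so that the requirements that the members of \<^term>\<open>F\<close> are subsets
  of \<^term>\<open>P\<close> and have pairwise different convex hulls can be expressed.\<close>

definition convex_hull_thrackle :: "point set \<Rightarrow> point set set \<Rightarrow> bool" where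
  "convex_hull_thrackle P F \<longleftrightarrow>
     finite P \<and> general_position P \<and> F \<subseteq> Pow P \<and> inj_on (\<lambda>S. convex hull S) F \<and>
     (\<forall>C1\<in>conv_hulls F. \<forall>C2\<in>conv_hulls F. C1 \<noteq> C2 \<longrightarrow> \<not> C1 \<subseteq> C2) \<and>
     (\<forall>C1\<in>conv_hulls F. \<forall>C2\<in>conv_hulls F. C1 \<noteq> C2 \<longrightarrow> C1 \<inter> C2 \<noteq> {}) \<and>
     (\<forall>C1\<in>conv_hulls F. \<forall>C2\<in>conv_hulls F. \<forall>C3\<in>conv_hulls F.
        C1 \<noteq> C2 \<and> C1 \<noteq> C3 \<and> C2 \<noteq> C3 \<longrightarrow> C1 \<inter> C2 \<inter> C3 \<subseteq> P)"

end

theory Submission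
  imports Defs "HOL-Computational_Algebra.Polynomial"
begin

text \<open>
  Six base points carry seven triangles that meet three at a time only in common vertices. Five of
  the triangles share the vertex \<open>b\<close>, the two others are \<open>ade\<close> and \<open>def\<close>. Every further point
  \<open>w\<close> is taken on a short convex arc facing \<open>b\<close>; it is added to both \<open>ade\<close> and \<open>def\<close>,
  and the segment \<open>bw\<close> becomes a new member of the family. No two of the five triangles
  overlap along \<open>bw\<close> except in \<open>b\<close>, and \<open>bw\<close> meets each of the two enlarged hulls in \<open>w\<close>
  alone, because the tangent of the arc at \<open>w\<close> separates \<open>b\<close> from both.
  Each new point thus contributes exactly one new hull.
\<close>

section \<open>Plane geometry in coordinates\<close>

definition pt :: "real \<Rightarrow> real \<Rightarrow> point" where
  "pt x y = vector [x, y]"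

lemma pt_component [simp]: "pt x y $ 1 = x" "pt x y $ 2 = y"
  by (simp_all add: pt_def)

lemma eq_pt_iff: "z = pt x y \<longleftrightarrow> z $ 1 = x \<and> z $ 2 = y"
  by (simp add: vec_eq_iff forall_2)

text \<open>Twice the signed area of the triangle with vertices \<open>p\<close>, \<open>q\<close>,
  \<open>r\<close>.\<close>

definition orient :: "point \<Rightarrow> point \<Rightarrow> point \<Rightarrow> real" where
  "orient p q r = (q $ 1 - p $ 1) * (r $ 2 - p $ 2) - (q $ 2 - p $ 2) * (r $ 1 - p $ 1)"

lemma collinear_orient:
  assumes "collinear {p, q, r}"
  shows "orient p q r = 0"
proof -
  consider "p = r" | u where "q = u *\<^sub>R p + (1 - u) *\<^sub>R r"
    using assms by (auto simp: collinear_3_expand)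
  then show ?thesis
  proof cases
    case 1
    then show ?thesis by (simp add: orient_def)
  next
    case 2
    show ?thesis unfolding 2 orient_def by (simp add: algebra_simps)
  qed
qed

text \<open>A half-plane is convex, so the generating points decide. Most questions about
  intersections of hulls are reduced in this way to linear arithmetic.\<close>

lemma hull_halfplane:
  fixes S :: "point set"
  assumes "z \<in> convex hull S" and "\<And>p. p \<in> S \<Longrightarrow> \<alpha> * p $ 1 + \<beta> * p $ 2 \<le> \<gamma>"
  shows "\<alpha> * z $ 1 + \<beta> * z $ 2 \<le> \<gamma>"
proof -
  have inner: "inner (pt \<alpha> \<beta>) p = \<alpha> * p $ 1 + \<beta> * p $ 2" for p
    by (simp add: inner_vec_def sum_2)
  have "convex hull S \<subseteq> {p. inner (pt \<alpha> \<beta>) p \<le> \<gamma>}"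
    using assms(2) by (intro hull_minimal convex_halfspace_le) (auto simp: inner)
  with assms(1) show ?thesis by (auto simp: inner)
qed

lemma segment_functional:
  fixes p q :: point
  assumes "z \<in> convex hull {p, q}"
    and "\<alpha> * z $ 1 + \<beta> * z $ 2 \<ge> \<gamma>" "\<alpha> * p $ 1 + \<beta> * p $ 2 < \<gamma>" "\<alpha> * q $ 1 + \<beta> * q $ 2 = \<gamma>"
  shows "z = q"
proof -
  obtain u where u: "0 \<le> u" "u \<le> 1" and z: "z = (1 - u) *\<^sub>R p + u *\<^sub>R q"
    using assms(1) by (auto simp: segment_convex_hull[symmetric] in_segment)
  have "\<alpha> * z $ 1 + \<beta> * z $ 2 = (1 - u) * (\<alpha> * p $ 1 + \<beta> * p $ 2) + u * \<gamma>"
    unfolding z assms(4)[symmetric] by (simp add: algebra_simps)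
  then have "(1 - u) * (\<gamma> - (\<alpha> * p $ 1 + \<beta> * p $ 2)) \<le> 0"
    using assms(2) by (simp add: algebra_simps)
  then have "u = 1"
    using u assms(3) by (simp add: mult_le_0_iff)
  then show ?thesis by (simp add: z)
qed

lemma segments_Int:
  fixes p q r :: "'a::euclidean_space"
  assumes "\<not> collinear {p, q, r}"
  shows "convex hull {p, q} \<inter> convex hull {p, r} = {p}"
proof -
  have "\<not> collinear {q, p, r}"
    using assms by (simp add: insert_commute)
  then have "closed_segment q p \<inter> closed_segment p r = {p}"
    by (intro Int_closed_segment) auto
  then show ?thesis
    by (simp add: segment_convex_hull insert_commute)
qed

lemma Int3_subsetI:
  assumes "\<And>z. z \<in> A \<Longrightarrow> z \<in> B \<Longrightarrow> z \<in> C \<Longrightarrow> z $ 1 = x \<and> z $ 2 = y" and "pt x y \<in> P"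
  shows "A \<inter> B \<inter> C \<subseteq> P"
proof
  fix z assume "z \<in> A \<inter> B \<inter> C"
  then have "z = pt x y"
    using assms(1) by (simp add: eq_pt_iff)
  with assms(2) show "z \<in> P" by simp
qed

section \<open>General position\<close>

lemma general_position_insert:
  assumes "general_position P"
    and "\<And>p q. p \<in> P \<Longrightarrow> q \<in> P \<Longrightarrow> p \<noteq> q \<Longrightarrow> \<not> collinear {p, q, r}"
  shows "general_position (insert r P)"
proof -
  have "\<not> collinear {r, p, q} \<and> \<not> collinear {p, r, q} \<and> \<not> collinear {p, q, r}"
    if "p \<in> P" "q \<in> P" "p \<noteq> q" for p q
    using assms(2)[OF that] by (simp add: insert_commute)
  then show ?thesis
    using assms(1) unfolding general_position_def by auto
qed

abbreviation parabola :: "real \<Rightarrow> point" where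
  "parabola t \<equiv> pt t (t\<^sup>2)"

lemma finite_parabola_line:
  assumes "p \<noteq> q"
  shows "finite {t. collinear {p, q, parabola t}}"
proof -
  \<comment> \<open>\<open>poly r t\<close> is \<open>orient p q (parabola t)\<close> sorted by
    powers of \<open>t\<close>; \<open>p \<noteq> q\<close> makes its linear or its quadratic
    coefficient nonzero.\<close>
  define r where "r = [: (q $ 2 - p $ 2) * p $ 1 - (q $ 1 - p $ 1) * p $ 2,
                        - (q $ 2 - p $ 2), q $ 1 - p $ 1 :]"
  have "r \<noteq> 0"
    using assms by (auto simp: r_def vec_eq_iff forall_2)
  then have "finite {t. poly r t = 0}"
    by (rule poly_roots_finite)
  moreover have "poly r t = 0" if "collinear {p, q, parabola t}" for t
    using collinear_orient[OF that]
    by (simp add: r_def orient_def algebra_simps power2_eq_square)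
  ultimately show ?thesis
    by (elim finite_subset[rotated]) (rule Collect_mono, rule impI)
qed

text \<open>A line meets the parabola in finitely many points, so all but finitely many parameters avoid
  the lines through two points already chosen.\<close>

lemma extend_general_position:
  assumes "finite P" "general_position P" "infinite I"
  shows "\<exists>T. T \<subseteq> I \<and> finite T \<and> card T = k \<and> general_position (P \<union> parabola ` T)"
proof (induction k)
  case 0
  then show ?case using assms by (intro exI[of _ "{}"]) auto
next
  case (Suc k)
  then obtain T where T: "T \<subseteq> I" "finite T" "card T = k" "general_position (P \<union> parabola ` T)"
    by blast
  let ?Q = "P \<union> parabola ` T"
  define B where "B = T \<union> (\<Union>p\<in>?Q. \<Union>q\<in>?Q - {p}. {t. collinear {p, q, parabola t}})"
  have "finite B"
    unfolding B_def using assms(1) T(2)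
    by (intro finite_UnI finite_UN_I finite_Diff finite_imageI finite_parabola_line) auto
  then have "\<not> I \<subseteq> B"
    using assms(3) finite_subset by blast
  then obtain t where t: "t \<in> I" "t \<notin> B"
    by blast
  have "general_position (insert (parabola t) ?Q)"
    using T(4) t(2) by (intro general_position_insert) (auto simp: B_def)
  moreover have "t \<notin> T"
    using t(2) by (simp add: B_def)
  ultimately show ?case
    using T t(1) by (intro exI[of _ "insert t T"]) auto
qed

section \<open>Checking thrackles along a list\<close>

text \<open>Analogue of \<open>sorted_wrt\<close> for three entries in list order. On an explicit
  list it unfolds to one condition per triple, 35 of them for seven sets.\<close>

fun triplewise :: "('a \<Rightarrow> 'a \<Rightarrow> 'a \<Rightarrow> bool) \<Rightarrow> 'a list \<Rightarrow> bool" where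
  "triplewise R [] \<longleftrightarrow> True"
| "triplewise R (x # xs) \<longleftrightarrow> sorted_wrt (R x) xs \<and> triplewise R xs"

lemma sorted_wrt_symD:
  assumes "sorted_wrt R xs" "\<And>x y. R x y \<Longrightarrow> R y x" "x \<in> set xs" "y \<in> set xs" "x \<noteq> y"
  shows "R x y"
  using assms(1,3-5) by (induction xs) (auto intro: assms(2))

lemma sorted_wrt_if_all:
  assumes "\<And>x y. x \<in> set xs \<Longrightarrow> y \<in> set xs \<Longrightarrow> R x y"
  shows "sorted_wrt R xs"
  using assms by (induction xs) auto

text \<open>The two transpositions generate all permutations of the arguments, so the order of the
  entries in the list does not matter.\<close>

lemma triplewise_symD:
  assumes "triplewise R xs" and sym: "\<And>x y z. R x y z \<Longrightarrow> R x z y" "\<And>x y z. R x y z \<Longrightarrow> R y x z"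
    and "x \<in> set xs" "y \<in> set xs" "z \<in> set xs" "x \<noteq> y" "x \<noteq> z" "y \<noteq> z"
  shows "R x y z"
  using assms(1,4-)
proof (induction xs)
  case (Cons a xs)
  have *: "R a u v" if "u \<in> set xs" "v \<in> set xs" "u \<noteq> v" for u v
    using Cons.prems(1) that by (auto intro: sorted_wrt_symD[of "R a"] sym(1))
  show ?case
    using Cons * by (auto intro: sym)
qed simp

lemma triplewise_mono:
  assumes "triplewise R xs" and "\<And>x y z. R x y z \<Longrightarrow> R' x y z"
  shows "triplewise R' xs"
  using assms(1)
proof (induction xs)
  case (Cons x xs)
  then show ?case
    using sorted_wrt_mono_rel[of xs "R x" "R' x"] assms(2) by auto
qed simp

abbreviation hulls_ok :: "point set \<Rightarrow> point set \<Rightarrow> bool" where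
  "hulls_ok A B \<equiv> \<not> convex hull A \<subseteq> convex hull B \<and> \<not> convex hull B \<subseteq> convex hull A \<and>
     convex hull A \<inter> convex hull B \<noteq> {}"

abbreviation meet_within :: "point set \<Rightarrow> point set \<Rightarrow> point set \<Rightarrow> point set \<Rightarrow> bool" where
  "meet_within P A B C \<equiv> convex hull A \<inter> convex hull B \<inter> convex hull C \<subseteq> P"

text \<open>When neither hull captures a foreign point of \<open>P\<close>, a vertex in
  \<open>P\<close> belonging to only one of the sets witnesses non-inclusion, and a common vertex
  makes the hulls meet. Geometry is thus replaced by a comparison of vertex sets.\<close>

lemma hulls_okI:
  assumes "\<And>p. p \<in> P \<Longrightarrow> p \<in> convex hull A \<Longrightarrow> p \<in> A"
    and "\<And>p. p \<in> P \<Longrightarrow> p \<in> convex hull B \<Longrightarrow> p \<in> B"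
    and "\<not> A \<inter> P \<subseteq> B \<and> \<not> B \<inter> P \<subseteq> A \<and> A \<inter> B \<noteq> {}"
  shows "hulls_ok A B"
  using assms hull_subset[of A convex] hull_subset[of B convex] by blast

lemma thrackle_list:
  assumes "finite P" "general_position P" "set Ls \<subseteq> Pow P"
    and ok: "sorted_wrt hulls_ok Ls" and tri: "triplewise (meet_within P) Ls"
  shows "convex_hull_thrackle P (set Ls)" and "card (conv_hulls (set Ls)) = length Ls"
proof -
  have two: "hulls_ok A B" if "A \<in> set Ls" "B \<in> set Ls" "A \<noteq> B" for A B
    using sorted_wrt_symD[OF ok _ that] by blast
  have three: "meet_within P A B C"
    if "A \<in> set Ls" "B \<in> set Ls" "C \<in> set Ls" "A \<noteq> B" "A \<noteq> C" "B \<noteq> C" for A B C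
    using triplewise_symD[OF tri _ _ that] by blast
  have inj: "inj_on (\<lambda>S. convex hull S) (set Ls)"
    using two by (intro inj_onI) blast
  have "meet_within P A B C"
    if "A \<in> set Ls" "B \<in> set Ls" "C \<in> set Ls" "convex hull A \<noteq> convex hull B"
      "convex hull A \<noteq> convex hull C" "convex hull B \<noteq> convex hull C" for A B C
    using three[OF that(1-3)] that(4-) by blast
  moreover have "hulls_ok A B"
    if "A \<in> set Ls" "B \<in> set Ls" "convex hull A \<noteq> convex hull B" for A B
    using two[OF that(1,2)] that(3) by blast
  ultimately show "convex_hull_thrackle P (set Ls)"
    unfolding convex_hull_thrackle_def conv_hulls_def ball_simps
    using assms(1-3) inj by (intro conjI ballI impI) (assumption | simp)+
  \<comment> \<open>\<open>hulls_ok A A\<close> is false, so no set can occur twice.\<close>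
  have "distinct Ls"
    using ok by (induction Ls) auto
  then show "card (conv_hulls (set Ls)) = length Ls"
    unfolding conv_hulls_def using inj by (simp add: card_image distinct_card)
qed

section \<open>The configuration\<close>

text \<open>The coordinates come from a computer search over six-point configurations.\<close>

abbreviation "pa \<equiv> pt (-32) 7"
abbreviation "pb \<equiv> pt (-29) (-15)"
abbreviation "pc \<equiv> pt (-34) (-27)"
abbreviation "pd \<equiv> pt (-33) 9"
abbreviation "pe \<equiv> pt (-11) 2"
abbreviation "pf \<equiv> pt (-16) 3"

abbreviation base :: "point set" where
  "base \<equiv> {pa, pb, pc, pd, pe, pf}"

text \<open>The tangent at parameter t is 2 t x - y = t^2. The bound 1/4 keeps \<open>pb\<close>
  strictly beyond all these tangents: 15 - 58 t > t^2.\<close>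

definition arc :: "point set" where
  "arc = parabola ` {0<..<1/4}"

text \<open>Only linear bounds on the coordinates are passed on, so that the half-plane checks for
  arc points stay linear.\<close>

lemma arcE:
  assumes "w \<in> arc"
  obtains x y where "w = pt x y" "0 < x" "x < 1/4" "0 < y" "4 * y < x"
proof -
  obtain t where t: "w = parabola t" "0 < t" "t < 1/4"
    using assms by (auto simp: arc_def)
  have "t * t < 1/4 * t"
    using t by (intro mult_strict_right_mono)
  then have "4 * t\<^sup>2 < t" by (simp add: power2_eq_square)
  then show thesis using t by (intro that[of t "t\<^sup>2"]) simp_all
qed

lemma general_position_base: "general_position base"
proof -
  have nc: "\<not> collinear {p, q, r}" if "orient p q r \<noteq> 0" for p q r
    using collinear_orient that by blast
  show ?thesis
    by (intro general_position_insert) (auto intro!: nc simp: orient_def general_position_def)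
qed

section \<open>Half-planes bounding the hulls\<close>

text \<open>The three inequalities are the edge lines of the triangle, and likewise for the other
  four triangles at \<open>pb\<close>. Neighbours in this fan lie on opposite sides of their common
  edge.\<close>

lemma halfplanes_bef:
  assumes "z \<in> convex hull {pb, pe, pf}"
  shows "17 * z $ 1 - 18 * z $ 2 \<le> -223 \<and> z $ 1 + 5 * z $ 2 \<le> -1 \<and> 18 * z $ 1 - 13 * z $ 2 \<ge> -327"
proof -
  have "17 * z $ 1 + -18 * z $ 2 \<le> -223"
    and "1 * z $ 1 + 5 * z $ 2 \<le> -1"
    and "-18 * z $ 1 + 13 * z $ 2 \<le> 327"
    by (rule hull_halfplane[OF assms(1)]; elim insertE emptyE; simp)+
  then show ?thesis by linarith
qed

lemma halfplanes_abf:
  assumes "z \<in> convex hull {pa, pb, pf}"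
  shows "22 * z $ 1 + 3 * z $ 2 \<ge> -683 \<and> 18 * z $ 1 - 13 * z $ 2 \<le> -327 \<and> z $ 1 + 4 * z $ 2 \<le> -4"
proof -
  have "-22 * z $ 1 + -3 * z $ 2 \<le> 683"
    and "18 * z $ 1 + -13 * z $ 2 \<le> -327"
    and "1 * z $ 1 + 4 * z $ 2 \<le> -4"
    by (rule hull_halfplane[OF assms(1)]; elim insertE emptyE; simp)+
  then show ?thesis by linarith
qed

lemma halfplanes_bce:
  assumes "z \<in> convex hull {pb, pc, pe}"
  shows "29 * z $ 1 - 23 * z $ 2 \<le> -365 \<and> 17 * z $ 1 - 18 * z $ 2 \<ge> -223 \<and> 12 * z $ 1 - 5 * z $ 2 \<ge> -273"
proof -
  have "29 * z $ 1 + -23 * z $ 2 \<le> -365"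
    and "-17 * z $ 1 + 18 * z $ 2 \<le> 223"
    and "-12 * z $ 1 + 5 * z $ 2 \<le> 273"
    by (rule hull_halfplane[OF assms(1)]; elim insertE emptyE; simp)+
  then show ?thesis by linarith
qed

lemma halfplanes_bcd:
  assumes "z \<in> convex hull {pb, pc, pd}"
  shows "12 * z $ 1 - 5 * z $ 2 \<le> -273 \<and> 6 * z $ 1 + z $ 2 \<le> -189 \<and> 36 * z $ 1 - z $ 2 \<ge> -1197"
proof -
  have "12 * z $ 1 + -5 * z $ 2 \<le> -273"
    and "6 * z $ 1 + 1 * z $ 2 \<le> -189"
    and "-36 * z $ 1 + 1 * z $ 2 \<le> 1197"
    by (rule hull_halfplane[OF assms(1)]; elim insertE emptyE; simp)+
  then show ?thesis by linarith
qed

lemma halfplanes_abd: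
  assumes "z \<in> convex hull {pa, pb, pd}"
  shows "6 * z $ 1 + z $ 2 \<ge> -189 \<and> 22 * z $ 1 + 3 * z $ 2 \<le> -683 \<and> 2 * z $ 1 + z $ 2 \<le> -57"
proof -
  have "-6 * z $ 1 + -1 * z $ 2 \<le> 189"
    and "22 * z $ 1 + 3 * z $ 2 \<le> -683"
    and "2 * z $ 1 + 1 * z $ 2 \<le> -57"
    by (rule hull_halfplane[OF assms(1)]; elim insertE emptyE; simp)+
  then show ?thesis by linarith
qed

text \<open>The first two lines are the edges ad and ae. The others hold for every choice of
  \<open>W\<close>: the line from e to the origin, the tangent at the origin, the vertical through
  the arc end (1/4, 1/16), and the line from d to that end.\<close>

lemma halfplanes_ade:
  assumes "z \<in> convex hull ({pa, pd, pe} \<union> W)" and "W \<subseteq> arc"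
  shows "2 * z $ 1 + z $ 2 \<ge> -57 \<and> 5 * z $ 1 + 21 * z $ 2 \<ge> -13 \<and> 2 * z $ 1 + 11 * z $ 2 \<ge> 0 \<and>
     z $ 2 \<ge> 0 \<and> 4 * z $ 1 \<le> 1 \<and> 143 * z $ 1 + 532 * z $ 2 \<le> 69"
proof -
  have "-2 * z $ 1 + -1 * z $ 2 \<le> 57"
    and "-5 * z $ 1 + -21 * z $ 2 \<le> 13"
    and "-2 * z $ 1 + -11 * z $ 2 \<le> 0"
    and "0 * z $ 1 + -1 * z $ 2 \<le> 0"
    and "4 * z $ 1 + 0 * z $ 2 \<le> 1"
    and "143 * z $ 1 + 532 * z $ 2 \<le> 69"
    by (rule hull_halfplane[OF assms(1)]; elim UnE insertE emptyE; (drule subsetD[OF assms(2)], elim arcE)?; simp)+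
  then show ?thesis by linarith
qed

lemma halfplanes_def:
  assumes "z \<in> convex hull ({pd, pe, pf} \<union> W)" and "W \<subseteq> arc"
  shows "6 * z $ 1 + 17 * z $ 2 \<ge> -45 \<and> z $ 1 + 5 * z $ 2 \<ge> -1 \<and> 2 * z $ 1 + 11 * z $ 2 \<ge> 0 \<and>
     z $ 2 \<ge> 0 \<and> 4 * z $ 1 \<le> 1 \<and> 143 * z $ 1 + 532 * z $ 2 \<le> 69"
proof -
  have "-6 * z $ 1 + -17 * z $ 2 \<le> 45"
    and "-1 * z $ 1 + -5 * z $ 2 \<le> 1"
    and "-2 * z $ 1 + -11 * z $ 2 \<le> 0"
    and "0 * z $ 1 + -1 * z $ 2 \<le> 0"
    and "4 * z $ 1 + 0 * z $ 2 \<le> 1"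
    and "143 * z $ 1 + 532 * z $ 2 \<le> 69"
    by (rule hull_halfplane[OF assms(1)]; elim UnE insertE emptyE; (drule subsetD[OF assms(2)], elim arcE)?; simp)+
  then show ?thesis by linarith
qed

text \<open>The lines join b to (1/4, 0), the origin to the arc end (1/4, 1/16), and b to the
  origin; they bound all segments from \<open>pb\<close> to the arc at once.\<close>

lemma halfplanes_pendant:
  assumes "z \<in> convex hull {pb, w}" and "w \<in> arc"
  shows "20 * z $ 1 - 39 * z $ 2 \<le> 5 \<and> z $ 1 - 4 * z $ 2 \<ge> 0 \<and> 15 * z $ 1 - 29 * z $ 2 \<ge> 0"
proof -
  have "20 * z $ 1 + -39 * z $ 2 \<le> 5"
    and "-1 * z $ 1 + 4 * z $ 2 \<le> 0"
    and "-15 * z $ 1 + 29 * z $ 2 \<le> 0"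
    by (rule hull_halfplane[OF assms(1)]; use assms(2) in \<open>elim insertE emptyE arcE; simp\<close>)+
  then show ?thesis by linarith
qed

lemma arc_not_base [simp]: "pa \<notin> arc" "pb \<notin> arc" "pc \<notin> arc" "pd \<notin> arc" "pe \<notin> arc" "pf \<notin> arc"
  by (auto simp: arc_def eq_pt_iff)

section \<open>The seven basic hulls\<close>

abbreviation fan :: "point set list" where
  "fan \<equiv> [{pb, pe, pf}, {pa, pb, pf}, {pb, pc, pe}, {pb, pc, pd}, {pa, pb, pd}]"

abbreviation family :: "point set \<Rightarrow> point set list" where
  "family W \<equiv> fan @ [{pa, pd, pe} \<union> W, {pd, pe, pf} \<union> W]"

lemmas halfplanes_fan = halfplanes_bef halfplanes_abf halfplanes_bce halfplanes_bcd halfplanes_abd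

text \<open>One instance for each of \<open>b\<close>, \<open>d\<close>, \<open>e\<close>, \<open>a\<close>, \<open>f\<close>; proof search backtracks over them. Any of
  them also serves for an empty intersection, since its first premise then has contradictory
  hypotheses.\<close>

lemmas Int3_baseI =
  Int3_subsetI[where x = "-29" and y = "-15"] Int3_subsetI[where x = "-33" and y = 9]
  Int3_subsetI[where x = "-11" and y = 2] Int3_subsetI[where x = "-32" and y = 7]
  Int3_subsetI[where x = "-16" and y = 3]

text \<open>For each triple the bounds of its three hulls are either contradictory or force the
  coordinates of one base point.\<close>

lemma family_triples:
  assumes "W \<subseteq> arc"
  shows "triplewise (meet_within base) (family W)"
proof -
  note hulls = halfplanes_fan halfplanes_ade[OF _ assms] halfplanes_def[OF _ assms]
  show ?thesis
    unfolding triplewise.simps sorted_wrt.simps append.simps list.set ball_simps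
    by (intro conjI TrueI; rule Int3_baseI, drule hulls, drule hulls, drule hulls, linarith, simp)
qed

lemma family_base:
  assumes "W \<subseteq> arc" "A \<in> set (family W)" "p \<in> base" "p \<in> convex hull A"
  shows "p \<in> A"
proof -
  have "\<forall>A\<in>set (family W). \<forall>p\<in>base. p \<in> convex hull A \<longrightarrow> p \<in> A"
    by (simp add: eq_pt_iff del: Un_insert_left)
      (intro conjI notI impI; (drule halfplanes_fan halfplanes_ade[OF _ assms(1)] halfplanes_def[OF _ assms(1)]); simp)
  then show ?thesis using assms(2-) by blast
qed

lemma pendant_base:
  assumes "w \<in> arc" "p \<in> base" "p \<in> convex hull {pb, w}"
  shows "p = pb"
  using assms(2) halfplanes_pendant[OF assms(3,1)] by (elim insertE emptyE; simp)

lemma arc_not_fan: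
  assumes "w \<in> arc" "A \<in> set fan"
  shows "w \<notin> convex hull A"
proof
  assume "w \<in> convex hull A"
  with assms show False
    by (simp del: insert_iff add: insert_iff[of A]) (elim arcE disjE; simp; drule halfplanes_fan; simp)
qed

text \<open>The traces on \<open>base\<close> are seven different three-element sets, any two of
  which share a vertex; by \<open>family_base\<close> this suffices.\<close>

lemma family_hulls_ok:
  assumes "W \<subseteq> arc"
  shows "sorted_wrt hulls_ok (family W)"
proof -
  have *: "hulls_ok A B" if "A \<in> set (family W)" "B \<in> set (family W)"
    "\<not> A \<inter> base \<subseteq> B \<and> \<not> B \<inter> base \<subseteq> A \<and> A \<inter> B \<noteq> {}" for A B
    using family_base[OF assms that(1)] family_base[OF assms that(2)] that(3) by (rule hulls_okI)
  have "pa \<notin> W" "pb \<notin> W" "pc \<notin> W" "pd \<notin> W" "pe \<notin> W" "pf \<notin> W"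
    using assms arc_not_base by blast+
  then have "sorted_wrt (\<lambda>A B. \<not> A \<inter> base \<subseteq> B \<and> \<not> B \<inter> base \<subseteq> A \<and> A \<inter> B \<noteq> {}) (family W)"
    by (simp add: eq_pt_iff)
  then show ?thesis
    using * by (rule sorted_wrt_mono_rel[rotated])
qed

section \<open>The segments from b to the arc\<close>

text \<open>The tangent at \<open>w\<close> supports the enlarged hull: for arc points this is (s -
  t)^2 \<ge> 0, and the vertices in \<open>A\<close> have negative first and positive second
  coordinate. As \<open>pb\<close> lies strictly on the other side, the segment reaches the tangent
  only at its end \<open>w\<close>.\<close>

lemma pendant_tangent:
  assumes "w \<in> arc" "W \<subseteq> arc" and A: "A = {pa, pd, pe} \<or> A = {pd, pe, pf}"
  shows "convex hull {pb, w} \<inter> convex hull (A \<union> W) \<subseteq> {w}"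
proof
  fix z assume z: "z \<in> convex hull {pb, w} \<inter> convex hull (A \<union> W)"
  obtain t where t: "w = parabola t" "0 < t" "t < 1/4"
    using assms(1) by (auto simp: arc_def)
  \<comment> \<open>At \<open>pb\<close> the functional 2 t x - y has the value 15 - 58 t > 1/2, so
    this crude bound already puts \<open>pb\<close> beyond the tangent.\<close>
  have t2: "t\<^sup>2 < 1/4"
    using t mult_strict_mono[of t "1/4" t 1] by (simp add: power2_eq_square)
  have "2 * t * p $ 1 + (- 1) * p $ 2 \<le> t\<^sup>2" if "p \<in> A \<union> W" for p
  proof (cases "p \<in> W")
    case True
    then obtain s where "p = parabola s"
      using assms(2) by (auto simp: arc_def)
    then show ?thesis
      using sum_squares_bound[of s t] by (simp add: algebra_simps)
  next
    case False
    then show ?thesis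
      using that A t by (auto intro!: order_trans[OF _ zero_le_power2])
  qed
  then have "2 * t * z $ 1 + (- 1) * z $ 2 \<le> t\<^sup>2"
    using z by (intro hull_halfplane[of z "A \<union> W"]) auto
  then have "z = w"
    using z t t2
    by (intro segment_functional[of z pb w "- (t\<^sup>2)" "- 2 * t" 1]) (auto simp: power2_eq_square)
  then show "z \<in> {w}" by simp
qed

text \<open>Segments from \<open>pb\<close> in different directions share only \<open>pb\<close>;
  hence every triple containing two of them is settled, whatever the third set \<open>C\<close>
  is.\<close>

lemma pendants_Int:
  assumes "\<not> collinear {pb, v, w}"
  shows "hulls_ok {pb, v} {pb, w}" and "meet_within {pb} {pb, v} {pb, w} C"
proof -
  have meet: "convex hull {pb, v} \<inter> convex hull {pb, w} = {pb}"
    using assms by (rule segments_Int)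
  moreover have "v \<noteq> pb" "w \<noteq> pb"
    using assms by (auto simp: insert_commute)
  moreover have "v \<in> convex hull {pb, v}" "w \<in> convex hull {pb, w}"
    by (simp_all add: hull_inc)
  ultimately show "hulls_ok {pb, v} {pb, w}" "meet_within {pb} {pb, v} {pb, w} C"
    by blast+
qed

text \<open>\<open>A\<close> has a base vertex other than \<open>pb\<close>, which the segment
  misses. Conversely, a fan triangle misses \<open>w\<close> and an enlarged hull misses
  \<open>pb\<close>; the other end of the segment is a common point.\<close>

lemma pendant_family_hulls_ok:
  assumes "W \<subseteq> arc" "w \<in> W" "A \<in> set (family W)"
  shows "hulls_ok {pb, w} A"
proof -
  have w: "w \<in> arc" using assms by blast
  have pb: "pb \<notin> W" using assms(1) arc_not_base by blast
  have inc: "A \<subseteq> convex hull A" "{pb, w} \<subseteq> convex hull {pb, w}"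
    by (simp_all add: hull_subset)
  have "\<exists>p\<in>base. p \<in> A \<and> p \<noteq> pb"
    using assms(3) by (auto simp: eq_pt_iff)
  then have 1: "\<not> convex hull A \<subseteq> convex hull {pb, w}"
    using pendant_base[OF w] inc(1) by blast
  show ?thesis
  proof (cases "A \<in> set fan")
    case True
    then have "pb \<in> A" by auto
    moreover have "w \<notin> convex hull A"
      using w True by (rule arc_not_fan)
    ultimately show ?thesis
      using 1 inc by blast
  next
    case False
    then have A: "A = {pa, pd, pe} \<union> W \<or> A = {pd, pe, pf} \<union> W"
      using assms(3) by auto
    then have "pb \<notin> A"
      using pb by (auto simp: eq_pt_iff)
    then have "pb \<notin> convex hull A"
      using family_base[OF assms(1,3), of pb] by blast
    moreover have "w \<in> A"
      using A assms(2) by blast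
    ultimately show ?thesis
      using 1 inc by blast
  qed
qed

lemma pendant_family_meet:
  assumes "W \<subseteq> arc" "w \<in> W"
  shows "sorted_wrt (meet_within (base \<union> W) {pb, w}) (family W)"
proof -
  have w: "w \<in> arc" using assms by blast
  have "sorted_wrt (meet_within base {pb, w}) fan"
    unfolding sorted_wrt.simps list.set ball_simps
    by (intro conjI TrueI; rule Int3_baseI, drule halfplanes_pendant[OF _ w], drule halfplanes_fan, drule halfplanes_fan, linarith, simp)
  then have fan: "sorted_wrt (meet_within (base \<union> W) {pb, w}) fan"
    by (rule sorted_wrt_mono_rel[rotated]) blast
  \<comment> \<open>A triple of the segment with at least one enlarged hull meets at most in
    \<open>w\<close>, a point of \<open>W\<close>.\<close>
  have meet: "convex hull {pb, w} \<inter> convex hull B \<subseteq> {w}"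
    if "B = {pa, pd, pe} \<union> W \<or> B = {pd, pe, pf} \<union> W" for B
    using pendant_tangent[OF w assms(1)] that by metis
  have "meet_within (base \<union> W) {pb, w} A B"
    if "B = {pa, pd, pe} \<union> W \<or> B = {pd, pe, pf} \<union> W" for A B
    using meet[OF that] assms(2) by blast
  with fan show ?thesis
    unfolding sorted_wrt_append by simp
qed

text \<open>Induction over the list of segments with \<open>W\<close> fixed, since the two enlarged
  hulls contain all of \<open>W\<close> from the start. A new segment is compared with earlier
  segments through \<open>pendants_Int\<close> and with the family through the tangent and
  half-plane arguments.\<close>

lemma pendants_family:
  assumes W: "W \<subseteq> arc" and gp: "general_position (base \<union> W)"
    and ws: "distinct ws" "set ws \<subseteq> W"
  shows "sorted_wrt hulls_ok (map (\<lambda>w. {pb, w}) ws @ family W) \<and>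
    triplewise (meet_within (base \<union> W)) (map (\<lambda>w. {pb, w}) ws @ family W)"
  using ws
proof (induction ws)
  case Nil
  have "triplewise (meet_within (base \<union> W)) (family W)"
    using family_triples[OF W] by (rule triplewise_mono) blast
  then show ?case
    using family_hulls_ok[OF W] by simp
next
  case (Cons w ws)
  have nc: "\<not> collinear {pb, w, v}" if "v \<in> set ws" for v
  proof -
    have "v \<in> W" "w \<in> W" "w \<noteq> v" "pb \<notin> W"
      using Cons.prems that W arc_not_base(2) by auto
    moreover from this have "pb \<noteq> w" "pb \<noteq> v"
      by auto
    ultimately show ?thesis
      using gp by (auto simp: general_position_def)
  qed
  have w: "w \<in> W" using Cons.prems by simp
  have "sorted_wrt (meet_within (base \<union> W) {pb, w}) (map (\<lambda>w. {pb, w}) ws)"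
    unfolding sorted_wrt_map using pendants_Int(2)[OF nc] by (intro sorted_wrt_if_all) blast
  moreover have "meet_within (base \<union> W) {pb, w} {pb, v} A" if "v \<in> set ws" for v A
    using pendants_Int(2)[OF nc[OF that]] by blast
  ultimately have "sorted_wrt (meet_within (base \<union> W) {pb, w}) (map (\<lambda>w. {pb, w}) ws @ family W)"
    unfolding sorted_wrt_append using pendant_family_meet[OF W w] by auto
  moreover have "\<forall>A \<in> set (map (\<lambda>w. {pb, w}) ws @ family W). hulls_ok {pb, w} A"
    unfolding set_append ball_Un using pendants_Int(1)[OF nc] pendant_family_hulls_ok[OF W w]
    by (auto simp del: set_append)
  ultimately show ?case
    using Cons by simp
qed

section \<open>Assembly and counting\<close>

theorem theorem1:
  fixes n :: nat
  assumes "n \<ge> 6"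
  shows "\<exists>(P :: point set) (F :: point set set).
           finite P \<and> card P = n \<and> general_position P \<and> F \<subseteq> Pow P \<and>
           convex_hull_thrackle P F \<and> card (conv_hulls F) = n + 1"
proof -
  obtain T where T: "T \<subseteq> {0<..<1/4}" "finite T" "card T = n - 6"
      and gp: "general_position (base \<union> parabola ` T)"
    using extend_general_position[OF _ general_position_base, of "{0<..<1/4}" "n - 6"] by auto
  define W where "W = parabola ` T"
  have W: "W \<subseteq> arc" "finite W"
    using T by (auto simp: W_def arc_def)
  have "inj_on parabola T"
    by (auto intro!: inj_onI simp: eq_pt_iff)
  then have card_W: "card W = n - 6"
    unfolding W_def using T(3) by (simp add: card_image)
  have "base \<inter> W = {}"
    using W(1) arc_not_base by blast
  moreover have "card base = 6"
    by (simp add: eq_pt_iff)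
  ultimately have card_P: "card (base \<union> W) = n"
    using W(2) card_W assms by (simp add: card_Un_disjoint del: Un_insert_left)
  obtain ws where ws: "set ws = W" "distinct ws"
    using finite_distinct_list[OF W(2)] by blast
  let ?Ls = "map (\<lambda>w. {pb, w}) ws @ family W"
  \<comment> \<open>There are n - 6 segments and seven further hulls; n \<ge> 6 makes the
    natural-number subtraction exact.\<close>
  have len: "length ?Ls = n + 1"
    using distinct_card[OF ws(2)] ws(1) card_W assms by simp
  have sub: "set ?Ls \<subseteq> Pow (base \<union> W)"
    using ws(1) by auto
  have gp: "general_position (base \<union> W)"
    using gp by (simp add: W_def)
  have fin: "finite (base \<union> W)"
    using W(2) by simp
  have "sorted_wrt hulls_ok ?Ls" "triplewise (meet_within (base \<union> W)) ?Ls"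
    using pendants_family[OF W(1) gp ws(2)] ws(1) by blast+
  note thrackle = thrackle_list[OF fin gp sub this]
  have "card (conv_hulls (set ?Ls)) = n + 1"
    using thrackle(2) len by (rule trans)
  with fin card_P gp sub thrackle(1) show ?thesis
    by (intro exI conjI)
qed

end
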